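(* Let $q$ be a power of $2$ and let \[ f(X)=X+\frac{1}{X-r}+\frac{1}{X-r^q}\in\mathbb{F}_q(X), \] where $r\in\mathbb{F}_{q^2}\setminus\mathbb{F}_q$. Then $f$ is a permutation rational function of $\mathbb{P}^1(\mathbb{F}_q)$ if and only if $r+r^q=1$.
   Context: $\mathbb{P}^1(\mathbb{F}_q)=\mathbb{F}_q\cup\{\infty\}$ is the projective line over $\mathbb{F}_q$. A rational function $f=P/Q\in\mathbb{F}_q(X)$ ($P,Q$ coprime) defines a map $\mathbb{P}^1(\mathbb{F}_q)\to\mathbb{P}^1(\mathbb{F}_q)$ in the usual way (zeros of $Q$ map to $\infty$, and $f(\infty)$ is the limiting value). A permutation rational function of $\mathbb{P}^1(\mathbb{F}_q)$ is a rational function whose induced map on $\mathbb{P}^1(\mathbb{F}_q)$ is a bijection. *)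

theory Defs
  imports "HOL-Computational_Algebra.Computational_Algebra" "HOL-Library.Cardinality"
begin

definition is_subfield :: "'a::field set \<Rightarrow> bool" where
  "is_subfield K \<longleftrightarrow>
     0 \<in> K \<and> 1 \<in> K \<and>
     (\<forall>x\<in>K. \<forall>y\<in>K. x - y \<in> K \<and> x * y \<in> K) \<and>
     (\<forall>x\<in>K. inverse x \<in> K)"

datatype 'a proj_line = Affine 'a | Infty

definition proj_line_over :: "'a set \<Rightarrow> 'a proj_line set" where
  "proj_line_over K = insert Infty (Affine ` K)"

text \<open>The subfield \<open>K(X)\<close> of the field \<open>'a(X)\<close> of rational functions.\<close>

definition ratfuns_over :: "'a::field set \<Rightarrow> 'a poly fract set" where
  "ratfuns_over K =
     {Fract P Q | P Q. Q \<noteq> 0 \<and> set (coeffs P) \<subseteq> K \<and> set (coeffs Q) \<subseteq> K}"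

text \<open>
  The map induced by \<open>P/Q\<close>, for coprime \<open>P\<close> and \<open>Q \<noteq> 0\<close>. If \<open>degree P \<le> degree Q\<close>, the
  limiting value at infinity is \<open>coeff P (degree Q) / lead_coeff Q\<close>: the quotient of the leading
  coefficients if the degrees agree, and \<open>0\<close> otherwise.
\<close>

definition quot_map :: "'a::field poly \<Rightarrow> 'a poly \<Rightarrow> 'a proj_line \<Rightarrow> 'a proj_line" where
  "quot_map P Q z = (case z of
       Affine x \<Rightarrow> if poly Q x = 0 then Infty else Affine (poly P x / poly Q x)
     | Infty \<Rightarrow> if degree P > degree Q then Infty else Affine (coeff P (degree Q) / lead_coeff Q))"

definition ratfun_map :: "'a::field poly fract \<Rightarrow> 'a proj_line \<Rightarrow> 'a proj_line" where
  "ratfun_map f =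
     (THE g. \<exists>P Q. Q \<noteq> 0 \<and> coprime P Q \<and> f = Fract P Q \<and> g = quot_map P Q)"

definition permutation_ratfun :: "'a::field set \<Rightarrow> 'a poly fract \<Rightarrow> bool" where
  "permutation_ratfun K f \<longleftrightarrow>
     f \<in> ratfuns_over K \<and> bij_betw (ratfun_map f) (proj_line_over K) (proj_line_over K)"

text \<open>
  The description in \<open>ratfun_map\<close> is definite: a representation in lowest terms exists and the
  induced map does not depend on it. The library's gcd-based normal form of fractions is not
  available for polynomials over an arbitrary type of class \<open>field\<close>.
\<close>

lemma poly_bezout:
  fixes P Q :: "'a::field poly"
  shows "\<exists>A B. A * P + B * Q dvd P \<and> A * P + B * Q dvd Q"
proof (induction "euclidean_size Q" arbitrary: P Q rule: less_induct)
  case less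
  show ?case
  proof (cases "Q = 0")
    case True
    then have "1 * P + 0 * Q dvd P \<and> 1 * P + 0 * Q dvd Q" by simp
    then show ?thesis by blast
  next
    case False
    then have "euclidean_size (P mod Q) < euclidean_size Q"
      by (rule mod_size_less)
    then obtain A B where AB: "A * Q + B * (P mod Q) dvd Q" "A * Q + B * (P mod Q) dvd P mod Q"
      using less by blast
    have eq: "A * Q + B * (P mod Q) = B * P + (A - B * (P div Q)) * Q"
      by (simp add: minus_div_mult_eq_mod [symmetric] algebra_simps)
    have "A * Q + B * (P mod Q) dvd P"
      using AB by (rule dvd_mod_imp_dvd [rotated])
    then show ?thesis using AB unfolding eq by blast
  qed
qed

lemma poly_coprime_dvd_mult:
  fixes P Q R :: "'a::field poly"
  assumes "coprime P Q" and "Q dvd P * R"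
  shows "Q dvd R"
proof -
  obtain A B where AB: "A * P + B * Q dvd P" "A * P + B * Q dvd Q"
    using poly_bezout by blast
  then have "is_unit (A * P + B * Q)"
    using assms(1) by (blast dest: coprime_common_divisor)
  then obtain U where U: "1 = (A * P + B * Q) * U" by (elim dvdE)
  have "R = ((A * P + B * Q) * U) * R" using U by simp
  also have "\<dots> = A * U * (P * R) + Q * (B * U * R)" by (simp add: algebra_simps)
  finally have "R = A * U * (P * R) + Q * (B * U * R)" .
  moreover have "Q dvd A * U * (P * R) + Q * (B * U * R)" using assms(2) by simp
  ultimately show ?thesis by simp
qed

lemma ex_coprime_quot:
  fixes f :: "'a::field poly fract"
  obtains P Q where "Q \<noteq> 0" and "coprime P Q" and "f = Fract P Q"
proof -
  obtain P Q where PQ: "f = Fract P Q" "Q \<noteq> 0" by (cases f) auto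
  obtain A B where AB: "A * P + B * Q dvd P" "A * P + B * Q dvd Q"
    using poly_bezout by blast
  define D where "D = A * P + B * Q"
  obtain P' Q' where P': "P = D * P'" and Q': "Q = D * Q'"
    using AB unfolding D_def by (elim dvdE)
  have nz: "D \<noteq> 0" "Q' \<noteq> 0" using PQ(2) Q' by auto
  have "D * (A * P' + B * Q') = D * 1"
    using D_def P' Q' by (simp add: algebra_simps)
  then have one: "A * P' + B * Q' = 1" using nz(1) mult_left_cancel by blast
  have "coprime P' Q'"
  proof (rule coprimeI)
    fix C assume "C dvd P'" "C dvd Q'"
    then have "C dvd A * P' + B * Q'" by simp
    then show "is_unit C" using one by simp
  qed
  moreover have "f = Fract P' Q'"
    using PQ nz by (simp add: P' Q' eq_fract)
  ultimately show thesis using that nz by blast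
qed

lemma quot_map_unique:
  fixes P Q P' Q' :: "'a::field poly"
  assumes "Q \<noteq> 0" "coprime P Q" "Q' \<noteq> 0" "coprime P' Q'" and eq: "Fract P Q = Fract P' Q'"
  shows "quot_map P Q = quot_map P' Q'"
proof -
  have cross: "P * Q' = P' * Q" using eq assms by (simp add: eq_fract)
  have "Q dvd Q'" using assms(2) cross by (metis dvd_triv_right poly_coprime_dvd_mult)
  moreover have "Q' dvd Q" using assms(4) cross by (metis dvd_triv_right poly_coprime_dvd_mult)
  ultimately obtain C D where C: "Q' = Q * C" and D: "Q = Q' * D"
    by (elim dvdE)
  have "Q * (C * D) = Q * 1" using C D by (metis mult.assoc mult.right_neutral)
  then have "C * D = 1" using assms(1) mult_left_cancel by blast
  then have "is_unit C" by (metis dvd_triv_left)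
  then obtain c where c: "C = [:c:]" by (auto simp: is_unit_poly_iff)
  have "c \<noteq> 0" using c C assms(3) by auto
  have Q': "Q' = smult c Q" using C c by (simp add: mult.commute)
  have "Q * P' = Q * smult c P" using cross by (simp add: Q' mult.commute)
  then have P': "P' = smult c P" using assms(1) mult_left_cancel by blast
  show ?thesis
    using \<open>c \<noteq> 0\<close> by (auto simp: fun_eq_iff quot_map_def P' Q' split: proj_line.split)
qed

lemma ratfun_map_Fract:
  assumes "Q \<noteq> 0" and "coprime P Q"
  shows "ratfun_map (Fract P Q) = quot_map P Q"
  unfolding ratfun_map_def
proof (rule the_equality)
  show "\<exists>P' Q'. Q' \<noteq> 0 \<and> coprime P' Q' \<and> Fract P Q = Fract P' Q' \<and> quot_map P Q = quot_map P' Q'"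
    using assms by blast
next
  fix g
  assume "\<exists>P' Q'. Q' \<noteq> 0 \<and> coprime P' Q' \<and> Fract P Q = Fract P' Q' \<and> g = quot_map P' Q'"
  then obtain P' Q' where *: "Q' \<noteq> 0" "coprime P' Q'" "Fract P Q = Fract P' Q'" "g = quot_map P' Q'"
    by blast
  show "g = quot_map P Q"
    unfolding *(4) using quot_map_unique [OF assms *(1-3)] by simp
qed

end

theory Submission
  imports Defs
begin

text \<open>
  Put \<open>t = r + r\<^sup>q\<close> and \<open>N = r\<^sup>q\<^sup>+\<^sup>1\<close>, so that \<open>f = X + t / (X\<^sup>2 + t X + N)\<close> with \<open>t, N \<in> K\<close>. This map
  fixes infinity and has no pole in \<open>K\<close>, so only injectivity on \<open>K\<close> matters. The substitution
  \<open>X = t u\<close> turns it into \<open>u + d\<^sup>2 / (u\<^sup>2 + u + M)\<close> with \<open>d = 1 / t\<close> and \<open>M = N / t\<^sup>2\<close>, up to the factor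
  \<open>t\<close>. The set \<open>AS\<close> of all \<open>u\<^sup>2 + u\<close> is an additive subgroup of index 2 in \<open>K\<close>, and \<open>M \<notin> AS\<close>. With
  \<open>A = u\<^sup>2 + u + M\<close> and \<open>s = u + v + 1\<close>, a collision between \<open>u\<close> and \<open>v \<noteq> u\<close> becomes a root \<open>s \<noteq> 1\<close> of
  \<open>A s\<^sup>2 + (A + d\<^sup>2) s + A\<^sup>2\<close> with \<open>A \<notin> AS\<close>. If \<open>A \<noteq> d\<^sup>2\<close>, this polynomial has a root in \<open>K\<close> if and
  only if \<open>d\<^sup>3 (d + 1) / (A + d\<^sup>2) \<notin> AS\<close>. For \<open>d = 1\<close> this never happens. Let \<open>d \<noteq> 1\<close>. If \<open>d\<^sup>2 \<notin> AS\<close>, then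
  \<open>A = d\<^sup>2\<close> and \<open>s = d\<close> give a collision. If \<open>d\<^sup>2 \<in> AS\<close>, then \<open>d \<in> AS\<close>, which excludes \<open>s = 1\<close>, as that
  forces \<open>A = d\<close>; it remains to find \<open>x = A + d\<^sup>2 \<notin> AS\<close> with \<open>h / x \<notin> AS\<close>, where \<open>h = d\<^sup>3 (d + 1) \<noteq> 0\<close>.
  It exists because \<open>x \<mapsto> h / x\<close> cannot inject the complement of \<open>AS\<close> into \<open>AS - {0}\<close>, which has
  fewer elements.
\<close>

subsection \<open>Finite subfields\<close>

locale subfield =
  fixes K :: "'a::field set"
  assumes is_subfield: "is_subfield K"
begin

lemma zero_mem [simp]: "0 \<in> K"
  and one_mem [simp]: "1 \<in> K"
  and diff_mem [simp]: "x \<in> K \<Longrightarrow> y \<in> K \<Longrightarrow> x - y \<in> K"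
  and mult_mem [simp]: "x \<in> K \<Longrightarrow> y \<in> K \<Longrightarrow> x * y \<in> K"
  and inverse_mem: "x \<in> K \<Longrightarrow> inverse x \<in> K"
  using is_subfield by (auto simp: is_subfield_def)

lemma uminus_mem: "x \<in> K \<Longrightarrow> - x \<in> K"
  using diff_mem [OF zero_mem] by simp

lemma add_mem [simp]: "x \<in> K \<Longrightarrow> y \<in> K \<Longrightarrow> x + y \<in> K"
  using diff_mem [OF _ uminus_mem] by simp

lemma divide_mem [simp]: "x \<in> K \<Longrightarrow> y \<in> K \<Longrightarrow> x / y \<in> K"
  by (simp add: divide_inverse inverse_mem)

lemma power_mem [simp]: "x \<in> K \<Longrightarrow> x ^ k \<in> K"
  by (induction k) auto

lemma sum_mem: "(\<And>i. i \<in> I \<Longrightarrow> g i \<in> K) \<Longrightarrow> sum g I \<in> K"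
  by (induction I rule: infinite_finite_induct) auto

lemma image_mult_left:
  assumes "x \<in> K" "x \<noteq> 0"
  shows "(*) x ` K = K"
proof
  show "K \<subseteq> (*) x ` K"
    using assms by (auto intro!: image_eqI [of _ _ "_ / x"])
qed (use assms in auto)

lemma image_add_left:
  assumes "x \<in> K"
  shows "(+) x ` K = K"
proof
  show "K \<subseteq> (+) x ` K"
    using assms by (auto intro!: image_eqI [of _ _ "_ - x"])
qed (use assms in auto)

lemma coeffs_subset_iff: "set (coeffs P) \<subseteq> K \<longleftrightarrow> (\<forall>i. coeff P i \<in> K)"
  using forall_coeffs_conv [of "\<lambda>c. c \<in> K" P] by (auto simp: subset_iff)

lemma Fract_mem_ratfuns_over:
  assumes "Q \<noteq> 0" "set (coeffs P) \<subseteq> K" "set (coeffs Q) \<subseteq> K"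
  shows "Fract P Q \<in> ratfuns_over K"
  using assms by (auto simp: ratfuns_over_def)

lemma ratfuns_over_add:
  assumes "f \<in> ratfuns_over K" "g \<in> ratfuns_over K"
  shows "f + g \<in> ratfuns_over K"
proof -
  obtain P Q R S where fg: "f = Fract P Q" "g = Fract R S" "Q \<noteq> 0" "S \<noteq> 0"
    and coeffs: "\<And>i. coeff P i \<in> K" "\<And>i. coeff Q i \<in> K" "\<And>i. coeff R i \<in> K" "\<And>i. coeff S i \<in> K"
    using assms by (auto simp: ratfuns_over_def coeffs_subset_iff)
  have "f + g = Fract (P * S + R * Q) (Q * S)"
    using fg by simp
  moreover have "set (coeffs (P * S + R * Q)) \<subseteq> K" "set (coeffs (Q * S)) \<subseteq> K"
    using coeffs unfolding coeffs_subset_iff by (auto simp: coeff_mult intro!: add_mem sum_mem)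
  moreover have "Q * S \<noteq> 0"
    using fg by simp
  ultimately show ?thesis
    by (simp add: Fract_mem_ratfuns_over)
qed

end

locale finite_subfield = subfield K for K :: "'a::field set" +
  assumes finite_K: "finite K"
begin

lemma CHAR_dvd_card: "CHAR('a) dvd card K"
proof -
  have "\<Sum>K = \<Sum>((+) 1 ` K)"
    by (simp only: image_add_left [OF one_mem])
  also have "\<dots> = of_nat (card K) + \<Sum>K"
    by (simp add: sum.reindex sum.distrib)
  finally show ?thesis
    by (simp add: of_nat_eq_0_iff_char_dvd)
qed

lemma CHAR_eq_of_card_prime_power:
  assumes "prime p" "card K = p ^ n"
  shows "CHAR('a) = p"
proof -
  have "CHAR('a) dvd p ^ n"
    using CHAR_dvd_card assms(2) by simp
  moreover from this have "prime CHAR('a)"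
    using assms(1) by (intro prime_CHAR_semidom Nat.gr0I) auto
  ultimately show ?thesis
    using assms(1) by (metis prime_dvd_power primes_dvd_imp_eq)
qed

lemma power_card_eq_same:
  assumes "x \<in> K"
  shows "x ^ card K = x"
proof (cases "x = 0")
  case True
  moreover have "card K \<noteq> 0"
    using finite_K zero_mem by (metis card_0_eq empty_iff)
  ultimately show ?thesis by simp
next
  case False
  have "\<Prod>(K - {0}) = \<Prod>((*) x ` (K - {0}))"
    using False assms by (simp add: image_set_diff inj_on_def image_mult_left)
  also have "\<dots> = x ^ card (K - {0}) * \<Prod>(K - {0})"
    using False by (simp add: prod.reindex inj_on_def prod.distrib)
  finally have "x ^ card (K - {0}) = 1"
    using finite_K by simp
  moreover have "card K = Suc (card (K - {0}))"
    using finite_K by (metis card.remove zero_mem)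
  ultimately show ?thesis
    by (simp only: power_Suc mult_1_right)
qed

lemma mem_iff_power_card: "x \<in> K \<longleftrightarrow> x ^ card K = x"
proof -
  define p :: "'a poly" where "p = monom 1 (card K) - monom 1 1"
  have "card {0, 1 :: 'a} \<le> card K"
    using finite_K by (intro card_mono) auto
  then have "card K > 1" by simp
  then have "coeff p (card K) = 1" "degree p \<le> card K"
    unfolding p_def by (auto intro!: degree_diff_le simp: degree_monom_eq)
  then have "p \<noteq> 0" "card {x. poly p x = 0} \<le> card K"
    using card_poly_roots_bound [of p] by fastforce+
  moreover have "K \<subseteq> {x. poly p x = 0}"
    using power_card_eq_same by (auto simp: p_def poly_monom)
  ultimately have "K = {x. poly p x = 0}"
    using poly_roots_finite card_seteq by blast
  then show ?thesis by (auto simp: p_def poly_monom)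
qed

lemma norm_mem:
  assumes "(x ^ card K) ^ card K = x"
  shows "x * x ^ card K \<in> K"
  by (simp add: mem_iff_power_card power_mult_distrib assms mult.commute)

lemma trace_mem:
  assumes "prime CHAR('a)" "card K = CHAR('a) ^ n" and "(x ^ card K) ^ card K = x"
  shows "x + x ^ card K \<in> K"
  using freshmans_dream' [OF assms(1,2)] assms(3) by (simp add: mem_iff_power_card add.commute)

end

lemma power_power_eq_same_of_CARD_eq_square:
  fixes x :: "'a::{finite, field}"
  assumes "CARD('a) = q\<^sup>2"
  shows "(x ^ q) ^ q = x"
proof -
  interpret finite_subfield "UNIV :: 'a set"
    by unfold_locales (auto simp: is_subfield_def)
  show ?thesis
    using power_card_eq_same [of x] assms by (simp add: power2_eq_square power_mult)
qed

subsection \<open>The Artin--Schreier map in characteristic 2\<close>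

locale binary_subfield = finite_subfield K for K :: "'a::field set" +
  assumes CHAR_2: "CHAR('a) = 2"
begin

lemma uminus_eq [simp]: "- x = (x::'a)"
  using CHAR_2 by (rule uminus_CHAR_2)

lemma minus_eq [simp]: "x - y = x + (y::'a)"
  using CHAR_2 by (rule minus_CHAR_2)

lemma two_eq_0 [simp]: "2 = (0::'a)"
  using of_nat_CHAR [where 'a = 'a] CHAR_2 by simp

lemma add_self_left [simp]: "x + (x + y) = (y::'a)"
  by (simp add: add.assoc [symmetric])

lemma add_eq_0_iff_eq [simp]: "x + y = 0 \<longleftrightarrow> x = (y::'a)"
  by (metis add_eq_0_iff uminus_eq)

lemma square_add: "(x + y)\<^sup>2 = x\<^sup>2 + (y::'a)\<^sup>2"
  by (rule freshmans_dream) (simp_all add: CHAR_2)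

lemma square_eq_iff [simp]: "x\<^sup>2 = y\<^sup>2 \<longleftrightarrow> x = (y::'a)"
  by (metis power2_eq_iff uminus_eq)

definition artin_schreier :: "'a \<Rightarrow> 'a" where
  "artin_schreier x = x\<^sup>2 + x"

lemma artin_schreier_mem [simp]: "x \<in> K \<Longrightarrow> artin_schreier x \<in> K"
  by (simp add: artin_schreier_def)

lemma artin_schreier_add: "artin_schreier (x + y) = artin_schreier x + artin_schreier y"
  by (simp add: artin_schreier_def square_add add_ac)

lemma artin_schreier_eq_mult: "artin_schreier x = x * (x + 1)"
  by (simp add: artin_schreier_def power2_eq_square algebra_simps)

lemma artin_schreier_eq_iff: "artin_schreier x = artin_schreier y \<longleftrightarrow> x = y \<or> x = y + 1"
proof -
  have "artin_schreier x = artin_schreier y \<longleftrightarrow> artin_schreier (x + y) = 0"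
    by (simp add: artin_schreier_add)
  also have "\<dots> \<longleftrightarrow> x = y \<or> x = y + 1"
    by (simp add: artin_schreier_eq_mult) (metis add_eq_0_iff_eq add.assoc)
  finally show ?thesis .
qed

text \<open>By additive Hilbert 90, these are the elements of absolute trace 0.\<close>

definition AS :: "'a set" where
  "AS = artin_schreier ` K"

lemma artin_schreier_mem_AS [simp]: "x \<in> K \<Longrightarrow> artin_schreier x \<in> AS"
  by (simp add: AS_def)

lemma AS_subset: "AS \<subseteq> K"
  by (auto simp: AS_def)

lemma finite_AS: "finite AS"
  by (simp add: AS_def finite_K)

lemma zero_mem_AS [simp]: "0 \<in> AS"
  using artin_schreier_mem_AS [OF zero_mem] by (simp add: artin_schreier_def)

lemma card_eq_twice_card_AS: "card K = 2 * card AS"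
proof -
  have fibre: "card {x \<in> K. artin_schreier x = a} = 2" if a: "a \<in> AS" for a
  proof -
    obtain u where "u \<in> K" "a = artin_schreier u"
      using a by (auto simp: AS_def)
    then have "{x \<in> K. artin_schreier x = a} = {u, u + 1}"
      by (auto simp: artin_schreier_eq_iff)
    then show ?thesis by simp
  qed
  have "card K = (\<Sum>a\<in>AS. card {x \<in> K. artin_schreier x = a})"
    using sum.image_gen [OF finite_K, of "\<lambda>_. 1::nat" artin_schreier]
    by (simp add: AS_def)
  then show ?thesis
    by (simp add: fibre)
qed

lemma card_compl_AS: "card (K - AS) = card AS"
  using card_eq_twice_card_AS by (simp add: card_Diff_subset finite_AS AS_subset)

lemma add_mem_AS:
  assumes "a \<in> AS" "b \<in> AS"
  shows "a + b \<in> AS"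
  using assms unfolding AS_def by (force simp flip: artin_schreier_add)

lemma add_mem_AS_left_iff: "a \<in> AS \<Longrightarrow> a + b \<in> AS \<longleftrightarrow> b \<in> AS"
  using add_mem_AS [of a b] add_mem_AS [of a "a + b"] by auto

text \<open>The subgroup \<open>AS\<close> has index 2, hence a single nontrivial coset.\<close>

lemma add_mem_AS_iff:
  assumes "a \<in> K" "b \<in> K"
  shows "a + b \<in> AS \<longleftrightarrow> (a \<in> AS \<longleftrightarrow> b \<in> AS)"
proof (cases "a \<in> AS")
  case True
  then show ?thesis
    by (simp add: add_mem_AS_left_iff)
next
  case False
  have "(+) a ` AS = K - AS"
  proof (rule card_seteq)
    show "(+) a ` AS \<subseteq> K - AS"
      using assms False AS_subset by (auto simp: add_mem_AS_left_iff add.commute [of a])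
  qed (simp_all add: finite_K card_compl_AS card_image)
  then have "b \<notin> AS \<longleftrightarrow> b \<in> (+) a ` AS"
    using assms by auto
  also have "\<dots> \<longleftrightarrow> a + b \<in> AS"
    by (force intro: image_eqI [of _ _ "a + b"])
  finally show ?thesis
    using False by blast
qed

lemma square_mem_AS_iff:
  assumes "a \<in> K"
  shows "a\<^sup>2 \<in> AS \<longleftrightarrow> a \<in> AS"
  using assms add_mem_AS_iff [of "a\<^sup>2" a] artin_schreier_mem_AS [of a]
  by (simp add: artin_schreier_def)

lemma ex_compl_AS_divide:
  assumes "h \<in> K" "h \<noteq> 0"
  obtains x where "x \<in> K - AS" "h / x \<in> K - AS"
proof -
  have nonzero: "x \<noteq> 0" if "x \<in> K - AS" for x
    using that by auto
  have "inj_on ((/) h) (K - AS)"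
    using assms(2) nonzero by (auto simp: inj_on_def field_simps)
  then have "card ((/) h ` (K - AS)) = card AS"
    by (simp add: card_image card_compl_AS)
  also have "\<dots> > card (AS - {0})"
    using finite_AS zero_mem_AS by (rule card_Diff1_less)
  finally have "\<not> (/) h ` (K - AS) \<subseteq> AS - {0}"
    using finite_AS by (metis card_mono finite_Diff not_le)
  then obtain x where "x \<in> K - AS" "h / x \<notin> AS - {0}"
    by (meson image_subsetI)
  moreover from this have "h / x \<in> K" "h / x \<noteq> 0"
    using assms nonzero by auto
  ultimately show thesis
    using that by blast
qed

lemma ex_quadratic_root_iff:
  assumes "a \<in> K" "a \<noteq> 0" "b \<in> K" "b \<noteq> 0" "c \<in> K"
  shows "(\<exists>x\<in>K. a * x\<^sup>2 + b * x + c = 0) \<longleftrightarrow> a * c / b\<^sup>2 \<in> AS"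
proof -
  have subst: "a * (b / a * w)\<^sup>2 + b * (b / a * w) + c = b\<^sup>2 / a * (artin_schreier w + a * c / b\<^sup>2)" for w
    using assms by (simp add: artin_schreier_def field_simps power2_eq_square)
  have "(\<exists>x\<in>K. a * x\<^sup>2 + b * x + c = 0) \<longleftrightarrow> (\<exists>x\<in>(*) (b / a) ` K. a * x\<^sup>2 + b * x + c = 0)"
    using assms image_mult_left [of "b / a"] by simp
  also have "\<dots> \<longleftrightarrow> (\<exists>w\<in>K. artin_schreier w = a * c / b\<^sup>2)"
    unfolding bex_simps(7) subst using assms by (simp del: times_divide_eq_left)
  also have "\<dots> \<longleftrightarrow> a * c / b\<^sup>2 \<in> AS"
    unfolding AS_def image_iff by metis
  finally show ?thesis .
qed

subsection \<open>Collisions of the normalized map\<close>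

definition normalized_map :: "'a \<Rightarrow> 'a \<Rightarrow> 'a \<Rightarrow> 'a" where
  "normalized_map e M u = u + e / (artin_schreier u + M)"

definition collision_quadratic :: "'a \<Rightarrow> 'a \<Rightarrow> 'a \<Rightarrow> 'a" where
  "collision_quadratic e A s = A * s\<^sup>2 + (A + e) * s + A\<^sup>2"

lemma normalized_map_eq_iff:
  fixes M :: 'a
  defines "D \<equiv> \<lambda>u. artin_schreier u + M"
  assumes "D u \<noteq> 0" "D v \<noteq> 0"
  shows "normalized_map e M u = normalized_map e M v \<longleftrightarrow> u = v \<or> D u * D v = e * (u + v + 1)"
proof -
  have "D u + D v = artin_schreier (u + v)"
    by (simp add: D_def artin_schreier_add add_ac)
  then have D_sum: "D u + D v = (u + v) * (u + v + 1)"
    by (simp add: artin_schreier_eq_mult)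
  have "normalized_map e M u = normalized_map e M v \<longleftrightarrow> u + e / D u + (v + e / D v) = 0"
    by (simp add: normalized_map_def D_def)
  also have "u + e / D u + (v + e / D v) = (u + v) + e * (D u + D v) / (D u * D v)"
    using assms(2,3) by (simp add: field_simps)
  also have "\<dots> = (u + v) * (D u * D v + e * (u + v + 1)) / (D u * D v)"
    unfolding D_sum using assms(2,3) by (simp add: field_simps)
  finally show ?thesis
    using assms(2,3) by simp
qed

lemma normalized_map_eq_shift_iff:
  assumes "artin_schreier u + M \<noteq> 0" "artin_schreier (u + 1 + s) + M \<noteq> 0"
  shows "normalized_map e M u = normalized_map e M (u + 1 + s) \<longleftrightarrow>
    s = 1 \<or> collision_quadratic e (artin_schreier u + M) s = 0"
proof -
  let ?A = "artin_schreier u + M"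
  have "artin_schreier (u + 1 + s) + M = ?A + artin_schreier s"
    by (simp add: artin_schreier_add artin_schreier_def [of 1] add_ac)
  then have "?A * (artin_schreier (u + 1 + s) + M) + e * s = collision_quadratic e ?A s"
    by (simp add: collision_quadratic_def artin_schreier_def [of s] power2_eq_square algebra_simps)
  then have "?A * (artin_schreier (u + 1 + s) + M) = e * s \<longleftrightarrow> collision_quadratic e ?A s = 0"
    by (metis add_eq_0_iff_eq)
  moreover have "u = u + 1 + s \<longleftrightarrow> s = 1" "u + (u + 1 + s) + 1 = s"
    by (auto simp: add_ac)
  ultimately show ?thesis
    using normalized_map_eq_iff [OF assms] by simp
qed

lemma artin_schreier_translate_image:
  assumes M: "M \<in> K - AS"
  shows "(\<lambda>u. artin_schreier u + M) ` K = K - AS"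
proof
  show "(\<lambda>u. artin_schreier u + M) ` K \<subseteq> K - AS"
    using M by (auto simp: add_mem_AS_iff)
  show "K - AS \<subseteq> (\<lambda>u. artin_schreier u + M) ` K"
  proof
    fix A assume "A \<in> K - AS"
    then have "A + M \<in> AS"
      using M by (simp add: add_mem_AS_iff)
    then obtain u where "u \<in> K" "A + M = artin_schreier u"
      by (auto simp: AS_def)
    moreover from this have "A = artin_schreier u + M"
      by (metis add_self_left add.commute)
    ultimately show "A \<in> (\<lambda>u. artin_schreier u + M) ` K" by blast
  qed
qed

lemma not_inj_on_normalized_map_iff:
  assumes "M \<in> K - AS"
  shows "\<not> inj_on (normalized_map e M) K \<longleftrightarrow>
    (\<exists>A\<in>K - AS. \<exists>s\<in>K - {1}. collision_quadratic e A s = 0)"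
proof -
  let ?g = "normalized_map e M"
  note image = artin_schreier_translate_image [OF assms]
  have nonzero: "artin_schreier u + M \<noteq> 0" if "u \<in> K" for u
    using image that zero_mem_AS by (metis DiffD2 imageI)
  have collision: "?g u = ?g (u + 1 + s) \<and> u \<noteq> u + 1 + s \<longleftrightarrow>
      s \<noteq> 1 \<and> collision_quadratic e (artin_schreier u + M) s = 0" if "u \<in> K" "s \<in> K" for u s
    using normalized_map_eq_shift_iff [of u M s e] nonzero [of u] nonzero [of "u + 1 + s"] that
    by (auto simp: add.assoc)
  have "\<not> inj_on ?g K \<longleftrightarrow> (\<exists>u\<in>K. \<exists>v\<in>K. ?g u = ?g v \<and> u \<noteq> v)"
    by (auto simp: inj_on_def)
  also have "\<dots> \<longleftrightarrow> (\<exists>u\<in>K. \<exists>v\<in>(+) (u + 1) ` K. ?g u = ?g v \<and> u \<noteq> v)"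
    by (simp add: image_add_left)
  also have "\<dots> \<longleftrightarrow>
      (\<exists>A\<in>(\<lambda>u. artin_schreier u + M) ` K. \<exists>s\<in>K - {1}. collision_quadratic e A s = 0)"
    using collision by (auto simp: Bex_def)
  finally show ?thesis
    unfolding image .
qed

lemma ex_collision_quadratic_root_iff:
  assumes A: "A \<in> K - AS" and d: "d \<in> K" and "A \<noteq> d\<^sup>2"
  shows "(\<exists>s\<in>K. collision_quadratic (d\<^sup>2) A s = 0) \<longleftrightarrow> d ^ 3 * (d + 1) / (A + d\<^sup>2) \<notin> AS"
proof -
  define x where "x = A + d\<^sup>2"
  have x: "x \<in> K" "x \<noteq> 0" and A_eq: "A = x + d\<^sup>2"
    using assms by (auto simp: x_def add.assoc)
  have "A \<noteq> 0" using A by auto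
  have "A * A\<^sup>2 / x\<^sup>2 = A + (artin_schreier (d ^ 3 / x) + d ^ 3 * (d + 1) / x)"
    unfolding A_eq using x
    by (simp add: artin_schreier_def field_simps power2_eq_square power3_eq_cube)
  also have "\<dots> \<in> AS \<longleftrightarrow> d ^ 3 * (d + 1) / x \<notin> AS"
    using A d x by (simp add: add_mem_AS_iff)
  finally show ?thesis
    using ex_quadratic_root_iff [of A x "A\<^sup>2"] A \<open>A \<noteq> 0\<close> x
    unfolding x_def collision_quadratic_def by simp
qed

lemma collision_quadratic_1_nonzero:
  assumes "A \<in> K - AS" and s: "s \<in> K - {1}"
  shows "collision_quadratic 1 A s \<noteq> 0"
proof
  assume root: "collision_quadratic 1 A s = 0"
  then have "A \<noteq> 1"
    using s square_eq_iff [of s 1] by (auto simp: collision_quadratic_def)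
  then show False
    using ex_collision_quadratic_root_iff [OF assms(1) one_mem] s root by auto
qed

lemma ex_collision_quadratic_root:
  assumes d: "d \<in> K" "d \<noteq> 0" "d \<noteq> 1"
  shows "\<exists>A\<in>K - AS. \<exists>s\<in>K - {1}. collision_quadratic (d\<^sup>2) A s = 0"
proof (cases "d\<^sup>2 \<in> AS")
  case False
  moreover have "collision_quadratic (d\<^sup>2) (d\<^sup>2) d = 0"
    by (simp add: collision_quadratic_def power2_eq_square)
  ultimately show ?thesis
    using d by (intro bexI [of _ "d\<^sup>2"] bexI [of _ d]) auto
next
  case True
  obtain x where x: "x \<in> K - AS" "d ^ 3 * (d + 1) / x \<in> K - AS"
    using ex_compl_AS_divide [of "d ^ 3 * (d + 1)"] d by auto
  define A where "A = x + d\<^sup>2"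
  have A: "A \<in> K - AS" and x_eq: "x = A + d\<^sup>2"
    using x(1) d True by (auto simp: A_def add_mem_AS_iff add.assoc)
  have "A \<noteq> d\<^sup>2"
    using A True by blast
  then obtain s where s: "s \<in> K" "collision_quadratic (d\<^sup>2) A s = 0"
    using ex_collision_quadratic_root_iff [OF A d(1)] x(2) unfolding x_eq by blast
  have "s \<noteq> 1"
  proof
    assume "s = 1"
    then have "A\<^sup>2 = d\<^sup>2"
      using s(2) by (simp add: collision_quadratic_def add.assoc [symmetric])
    then show False
      using A True d by (simp add: square_mem_AS_iff)
  qed
  then show ?thesis
    using A s by blast
qed

lemma inj_on_normalized_map_iff:
  assumes M: "M \<in> K - AS" and d: "d \<in> K" "d \<noteq> 0"
  shows "inj_on (normalized_map (d\<^sup>2) M) K \<longleftrightarrow> d = 1"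
proof (cases "d = 1")
  case True
  then show ?thesis
    using not_inj_on_normalized_map_iff [OF M, of 1] collision_quadratic_1_nonzero by auto
next
  case False
  then show ?thesis
    using not_inj_on_normalized_map_iff [OF M] ex_collision_quadratic_root [OF d] by blast
qed

lemma inj_on_add_divide_quadratic_iff:
  assumes "t \<in> K" "t \<noteq> 0" "N \<in> K" and no_root: "\<And>x. x \<in> K \<Longrightarrow> x\<^sup>2 + t * x + N \<noteq> 0"
  shows "inj_on (\<lambda>x. x + t / (x\<^sup>2 + t * x + N)) K \<longleftrightarrow> t = 1" (is "inj_on ?h K \<longleftrightarrow> _")
proof -
  define d M where "d = 1 / t" and "M = N / t\<^sup>2"
  let ?g = "normalized_map (d\<^sup>2) M"
  have "M \<in> K - AS"
    using ex_quadratic_root_iff [of 1 t N] assms by (auto simp: M_def)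
  have h_scaled: "?h \<circ> (*) t = (*) t \<circ> ?g"
  proof
    fix u
    have "(t * u)\<^sup>2 + t * (t * u) + N = t\<^sup>2 * (artin_schreier u + M)"
      using assms by (simp add: artin_schreier_def M_def field_simps power2_eq_square)
    then show "(?h \<circ> (*) t) u = ((*) t \<circ> ?g) u"
      using assms by (simp add: normalized_map_def d_def field_simps power2_eq_square)
  qed
  have inj_mult: "inj_on ((*) t) S" for S
    using assms(2) by (simp add: inj_on_def)
  have "inj_on ?h K \<longleftrightarrow> inj_on ((*) t \<circ> ?g) K"
    using comp_inj_on_iff [OF inj_mult, of ?h K] assms by (simp add: image_mult_left h_scaled)
  also have "\<dots> \<longleftrightarrow> inj_on ?g K"
    using comp_inj_on [OF _ inj_mult] inj_on_imageI2 by blast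
  also have "\<dots> \<longleftrightarrow> d = 1"
    using assms \<open>M \<in> K - AS\<close> by (intro inj_on_normalized_map_iff) (auto simp: d_def)
  also have "\<dots> \<longleftrightarrow> t = 1"
    using assms by (auto simp: d_def)
  finally show ?thesis .
qed

end

subsection \<open>Rational functions on the projective line\<close>

lemma to_fract_add_divide:
  fixes P Q R :: "'a::idom"
  assumes "Q \<noteq> 0"
  shows "to_fract P + to_fract R / to_fract Q = Fract (P * Q + R) Q"
  using assms by (simp add: Fract_conv_to_fract field_simps)

lemma inverse_linear_add_inverse_linear:
  fixes r s :: "'a::field"
  shows "1 / to_fract [:- r, 1:] + 1 / to_fract [:- s, 1:] =
    to_fract [:- (r + s), 2:] / to_fract [:r * s, - (r + s), 1:]"
proof -
  have "[:r * s, - (r + s), 1:] = [:- r, 1:] * [:- s, 1:]"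
    and "[:- (r + s), 2:] = [:- r, 1:] + [:- s, 1:]"
    by simp_all
  then show ?thesis
    by (simp only: to_fract_mult to_fract_add) (simp add: field_simps)
qed

lemma ratfun_map_poly_add_divide:
  fixes P Q R :: "'a::field poly"
  assumes "Q \<noteq> 0" "coprime R Q"
  shows "ratfun_map (to_fract P + to_fract R / to_fract Q) = quot_map (P * Q + R) Q"
proof -
  have "coprime (P * Q + R) Q"
    using assms(2) by (auto simp: coprime_def dvd_add_right_iff)
  then show ?thesis
    using assms(1) by (simp add: to_fract_add_divide ratfun_map_Fract)
qed

lemma ratfun_map_poly_add_divide_Infty:
  fixes P Q R :: "'a::field poly"
  assumes "Q \<noteq> 0" "coprime R Q" "degree R \<le> degree Q" "degree P > 0"
  shows "ratfun_map (to_fract P + to_fract R / to_fract Q) Infty = Infty"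
proof -
  have "P \<noteq> 0"
    using assms(4) by auto
  then have "degree (P * Q) = degree P + degree Q"
    using assms(1) by (rule degree_mult_eq)
  then have "degree (P * Q + R) > degree Q"
    using assms(3,4) by (simp add: degree_add_eq_left)
  then show ?thesis
    using assms(1,2) by (simp add: ratfun_map_poly_add_divide quot_map_def)
qed

lemma ratfun_map_poly_add_divide_Affine:
  fixes P Q R :: "'a::field poly"
  assumes "coprime R Q" "poly Q x \<noteq> 0"
  shows "ratfun_map (to_fract P + to_fract R / to_fract Q) (Affine x) =
    Affine (poly P x + poly R x / poly Q x)"
proof -
  have "Q \<noteq> 0"
    using assms(2) by auto
  then show ?thesis
    using assms by (simp add: ratfun_map_poly_add_divide quot_map_def add_divide_distrib)
qed

lemma bij_betw_proj_line_over_iff: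
  assumes "F Infty = Infty" and "\<And>x. x \<in> K \<Longrightarrow> F (Affine x) = Affine (h x)"
  shows "bij_betw F (proj_line_over K) (proj_line_over K) \<longleftrightarrow> bij_betw h K K"
proof -
  have "inj_on F (proj_line_over K) \<longleftrightarrow> inj_on h K"
    using assms by (auto simp: inj_on_def proj_line_over_def)
  moreover have "F ` proj_line_over K = proj_line_over (h ` K)"
    using assms by (auto simp: proj_line_over_def image_iff)
  moreover have "proj_line_over (h ` K) = proj_line_over K \<longleftrightarrow> h ` K = K"
    by (auto simp: proj_line_over_def)
  ultimately show ?thesis
    unfolding bij_betw_def by simp
qed

context binary_subfield
begin

lemma X_add_divide_quadratic_mem_ratfuns_over:
  assumes "t \<in> K" "N \<in> K"
  shows "to_fract [:0, 1:] + to_fract [:t:] / to_fract [:N, t, 1:] \<in> ratfuns_over K"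
proof (rule ratfuns_over_add)
  show "to_fract [:0, 1:] \<in> ratfuns_over K"
    unfolding to_fract_def by (rule Fract_mem_ratfuns_over) auto
  show "to_fract [:t:] / to_fract [:N, t, 1:] \<in> ratfuns_over K"
    unfolding Fract_conv_to_fract [symmetric]
    by (rule Fract_mem_ratfuns_over) (use assms in \<open>auto simp: cCons_def\<close>)
qed

lemma permutation_ratfun_X_add_divide_quadratic_iff:
  assumes "t \<in> K" "t \<noteq> 0" "N \<in> K" and no_root: "\<And>x. x \<in> K \<Longrightarrow> x\<^sup>2 + t * x + N \<noteq> 0"
  shows "permutation_ratfun K (to_fract [:0, 1:] + to_fract [:t:] / to_fract [:N, t, 1:]) \<longleftrightarrow> t = 1"
    (is "permutation_ratfun K ?f \<longleftrightarrow> _")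
proof -
  let ?h = "\<lambda>x. x + t / (x\<^sup>2 + t * x + N)"
  have closed: "?h ` K \<subseteq> K"
    using assms(1,3) by auto
  have coprime: "coprime [:t:] [:N, t, 1:]"
    using assms(2) by (simp add: is_unit_left_imp_coprime is_unit_pCons_iff)
  have poly: "poly [:N, t, 1:] x = x\<^sup>2 + t * x + N" for x
    by (simp add: power2_eq_square algebra_simps)
  have "permutation_ratfun K ?f \<longleftrightarrow> bij_betw (ratfun_map ?f) (proj_line_over K) (proj_line_over K)"
    using X_add_divide_quadratic_mem_ratfuns_over [OF assms(1,3)]
    by (simp only: permutation_ratfun_def simp_thms)
  also have "\<dots> \<longleftrightarrow> bij_betw ?h K K"
  proof (rule bij_betw_proj_line_over_iff)
    show "ratfun_map ?f Infty = Infty"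
      using coprime by (intro ratfun_map_poly_add_divide_Infty) auto
    show "ratfun_map ?f (Affine x) = Affine (?h x)" if "x \<in> K" for x
      using ratfun_map_poly_add_divide_Affine [OF coprime, of x "[:0, 1:]"] no_root [OF that]
      unfolding poly by simp
  qed
  also have "\<dots> \<longleftrightarrow> inj_on ?h K"
    using endo_inj_surj [OF finite_K closed] by (auto simp: bij_betw_def)
  also have "\<dots> \<longleftrightarrow> t = 1"
    using assms by (rule inj_on_add_divide_quadratic_iff)
  finally show ?thesis .
qed

end

theorem theorem3p2:
  fixes q n :: nat
    and K :: "'a::{finite, field} set"
    and r :: 'a
    and f :: "'a poly fract"
  assumes "n > 0" and "q = 2 ^ n"
    and "CARD('a) = q ^ 2"
    and "is_subfield K" and "card K = q"
    and "r \<notin> K"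
    and "f = to_fract [:0, 1:] + 1 / to_fract [:- r, 1:] + 1 / to_fract [:- (r ^ q), 1:]"
  shows "f \<in> ratfuns_over K \<and> (permutation_ratfun K f \<longleftrightarrow> r + r ^ q = 1)"
proof -
  interpret finite_subfield K
    by unfold_locales (use assms(4) in auto)
  interpret binary_subfield K
    by unfold_locales (use CHAR_eq_of_card_prime_power assms(2,5) in auto)
  define t N where "t = r + r ^ q" and "N = r * r ^ q"
  have conj_conj: "(r ^ q) ^ q = r"
    using assms(3) by (rule power_power_eq_same_of_CARD_eq_square)
  then have conj_notin: "r ^ q \<notin> K" and "r \<noteq> r ^ q"
    using assms(5,6) mem_iff_power_card by force+
  then have t: "t \<in> K" "t \<noteq> 0"
    using trace_mem [of n r] conj_conj CHAR_2 assms(2,5) by (auto simp: t_def)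
  have N: "N \<in> K"
    using norm_mem [of r] conj_conj assms(5) by (simp add: N_def)
  have "x\<^sup>2 + t * x + N = (x + r) * (x + r ^ q)" for x
    by (simp add: t_def N_def power2_eq_square algebra_simps)
  then have no_root: "x\<^sup>2 + t * x + N \<noteq> 0" if "x \<in> K" for x
    using that assms(6) conj_notin by auto
  have "f = to_fract [:0, 1:] + to_fract [:t:] / to_fract [:N, t, 1:]"
    unfolding assms(7) add.assoc inverse_linear_add_inverse_linear
    by (simp add: t_def N_def)
  then show ?thesis
    using X_add_divide_quadratic_mem_ratfuns_over permutation_ratfun_X_add_divide_quadratic_iff
      t N no_root unfolding t_def by blast
qed

end
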